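(* Let $0<\mu\le L$ and let $f:\mathbb{R}^d\to\mathbb{R}$ be a continuously differentiable function. Let $(\theta_k)_{k\in\mathbb{N}_0}$ be the gradient descent scheme given by $$\theta_k=\theta_{k-1}-\gamma\nabla f(\theta_{k-1})\qquad(k\in\mathbb{N})$$ with $0<\gamma<\frac{2}{L}$, and let $\theta^\ast\in\mathbb{R}^d$ be a $(\mu,L)$-regular point. Then there exists an open neighborhood $V$ of $\theta^\ast$ such that the following statement is true: if there exists an $N\in\mathbb{N}_0$ with $\theta_N\in V$, then $(\theta_k)_{k\in\mathbb{N}_0}$ converges to a local minimum $\theta_\infty$ of $f$ with $f(\theta_\infty)=f(\theta^\ast)$, and for every $\varepsilon>0$ one has $$\limsup_{k\to\infty}\Big(\max\big(|1-\gamma\mu|,|1-\gamma L|\big)+\varepsilon\Big)^{-2k}\,\|\theta_k-\theta_\infty\|^2=0$$ and $$\limsup_{k\to\infty}\Big(\max\big(|1-\gamma\mu|,|1-\gamma L|\big)+\varepsilon\Big)^{-2k}\,\big(f(\theta_k)-f(\theta_\infty)\big)=0.$$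
   Context: Regular points: let $0<\mu\le L$ and let $f:\mathbb{R}^d\to\mathbb{R}$ be continuously differentiable. A local minimum $\theta^\ast\in\mathbb{R}^d$ of $f$ is called a $(\mu,L)$-regular point if there exists an open neighborhood $U\subset\mathbb{R}^d$ of $\theta^\ast$ such that (A1) $f|_U$ is twice continuously differentiable and $f(\theta)\ge f(\theta^\ast)$ for all $\theta\in U$; (A2) $\|\nabla f(\theta)\|^2\ge2\mu\,(f(\theta)-f(\theta^\ast))$ for all $\theta\in U$ (Polyak–Łojasiewicz inequality); (A3) $\|\nabla f(\theta)-\nabla f(\theta')\|\le L\|\theta-\theta'\|$ for all $\theta,\theta'\in U$. Here $\|\cdot\|$ is the Euclidean norm. *)

theory Defs
  imports "HOL-Analysis.Analysis"
begin

text \<open>The derivative is taken in the space of bounded linear maps, so its continuity is continuity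
  in operator norm. The notions are meant for open \<open>U\<close>.\<close>

definition C1_on :: "('a::euclidean_space \<Rightarrow> 'b::real_normed_vector) \<Rightarrow> 'a set \<Rightarrow> bool" where
  "C1_on f U \<longleftrightarrow>
     (\<exists>f' :: 'a \<Rightarrow> 'a \<Rightarrow>\<^sub>L 'b.
        (\<forall>x\<in>U. (f has_derivative blinfun_apply (f' x)) (at x)) \<and> continuous_on U f')"

definition C2_on :: "('a::euclidean_space \<Rightarrow> 'b::real_normed_vector) \<Rightarrow> 'a set \<Rightarrow> bool" where
  "C2_on f U \<longleftrightarrow>
     (\<exists>f' :: 'a \<Rightarrow> 'a \<Rightarrow>\<^sub>L 'b.
        (\<forall>x\<in>U. (f has_derivative blinfun_apply (f' x)) (at x)) \<and> C1_on f' U)"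

text \<open>Unspecified where \<open>f\<close> is not differentiable.\<close>

definition grad :: "('a::euclidean_space \<Rightarrow> real) \<Rightarrow> 'a \<Rightarrow> 'a" where
  "grad f x = (THE D. GDERIV f x :> D)"

lemma grad_eq:
  assumes "GDERIV f x :> D"
  shows "grad f x = D"
  unfolding grad_def
proof (rule the_equality)
  fix E assume "GDERIV f x :> E"
  then have "(\<lambda>h. inner h E) = (\<lambda>h. inner h D)"
    using assms has_derivative_unique unfolding gderiv_def by blast
  then have "inner (E - D) E = inner (E - D) D"
    by metis
  then have "inner (E - D) (E - D) = 0"
    by (simp add: inner_diff_right)
  then show "E = D"
    by simp
qed (rule assms)

lemma GDERIV_grad:
  assumes "(f has_derivative f') (at x)"
  shows "GDERIV f x :> grad f x"
proof -
  interpret f': bounded_linear f'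
    using assms by (rule has_derivative_bounded_linear)
  have "f' = (\<lambda>h. inner h (\<Sum>b\<in>Basis. f' b *\<^sub>R b))"
  proof
    fix h
    have "f' h = f' (\<Sum>b\<in>Basis. inner h b *\<^sub>R b)"
      by (simp add: euclidean_representation)
    also have "\<dots> = inner h (\<Sum>b\<in>Basis. f' b *\<^sub>R b)"
      by (simp add: f'.sum f'.scaleR inner_sum_right mult.commute)
    finally show "f' h = inner h (\<Sum>b\<in>Basis. f' b *\<^sub>R b)" .
  qed
  then have "GDERIV f x :> (\<Sum>b\<in>Basis. f' b *\<^sub>R b)"
    using assms by (simp add: gderiv_def)
  then show ?thesis
    using grad_eq by metis
qed

definition local_minimum :: "('a::topological_space \<Rightarrow> real) \<Rightarrow> 'a \<Rightarrow> bool" where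
  "local_minimum f x \<longleftrightarrow> (\<exists>U. open U \<and> x \<in> U \<and> (\<forall>y\<in>U. f x \<le> f y))"

definition regular_point ::
    "real \<Rightarrow> real \<Rightarrow> ('a::euclidean_space \<Rightarrow> real) \<Rightarrow> 'a \<Rightarrow> bool" where
  "regular_point \<mu> L f p \<longleftrightarrow>
     local_minimum f p \<and>
     (\<exists>U. open U \<and> p \<in> U \<and>
        C2_on f U \<and> (\<forall>x\<in>U. f x \<ge> f p) \<and>
        (\<forall>x\<in>U. (norm (grad f x))\<^sup>2 \<ge> 2 * \<mu> * (f x - f p)) \<and>
        (\<forall>x\<in>U. \<forall>y\<in>U. norm (grad f x - grad f y) \<le> L * norm (x - y)))"

definition gradient_descent ::
    "('a::euclidean_space \<Rightarrow> real) \<Rightarrow> real \<Rightarrow> (nat \<Rightarrow> 'a) \<Rightarrow> bool" where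
  "gradient_descent f \<gamma> \<theta> \<longleftrightarrow> (\<forall>k. \<theta> (Suc k) = \<theta> k - \<gamma> *\<^sub>R grad f (\<theta> k))"

end

theory Submission
  imports Defs
begin

text \<open>By the Polyak--Lojasiewicz inequality the step length is bounded by a multiple of the decrease
  of \<open>sqrt (f - f p)\<close>, so the iterates started near a regular point \<open>p\<close> stay near it and converge to some
  \<open>q\<close> with \<open>f q = f p\<close>; moreover \<open>norm (\<theta> k - q)\<close> and \<open>sqrt (f (\<theta> k) - f q)\<close> are bounded by a multiple of
  \<open>norm (grad f (\<theta> k))\<close>. It remains to find the rate at which the gradients decay. Let \<open>H\<close> be the Hessian
  at \<open>q\<close>. The gradients are asymptotically in the range of \<open>H\<close>, since
  \<open>grad f (\<theta> k) = H (\<theta> k - q) + o (norm (\<theta> k - q))\<close>, and the error is also \<open>o (norm (grad f (\<theta> k)))\<close>.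
  Hence one step multiplies the gradient by \<open>1 - \<gamma> H\<close> up to a relative error that vanishes. On the range of
  \<open>H\<close> we have \<open>\<mu> \<le> H \<le> L\<close>, so there \<open>1 - \<gamma> H\<close> has norm at most
  \<open>max \<bar>1 - \<gamma> \<mu>\<bar> \<bar>1 - \<gamma> L\<bar>\<close>. This avoids the manifold structure of the set of minima.\<close>

section \<open>Symmetric operators\<close>

text \<open>By polarization, the quadratic form of a symmetric operator controls its norm.\<close>

lemma symmetric_norm_le_on_subspace:
  fixes B :: "'a::real_inner \<Rightarrow> 'a"
  assumes "linear B" and W: "subspace W" and inv: "\<And>w. w \<in> W \<Longrightarrow> B w \<in> W"
    and sym: "\<And>x y. inner x (B y) = inner y (B x)"
    and bound: "\<And>w. w \<in> W \<Longrightarrow> \<bar>inner w (B w)\<bar> \<le> \<rho> * (norm w)\<^sup>2"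
    and w: "w \<in> W"
  shows "norm (B w) \<le> \<rho> * norm w"
proof (cases "B w = 0 \<or> w = 0")
  case True
  then show ?thesis
  proof
    assume 0: "B w = 0"
    show ?thesis
    proof (cases "w = 0")
      case False
      have "0 \<le> \<rho> * (norm w)\<^sup>2"
        using bound[OF w] by linarith
      then have "0 \<le> \<rho>"
        using False by (simp add: zero_le_mult_iff)
      then show ?thesis
        using 0 by simp
    qed (use 0 in simp)
  qed (use linear_0[OF \<open>linear B\<close>] in simp)
next
  case False
  interpret B: linear B by fact
  \<comment> \<open>The test vector \<open>y\<close> is \<open>B w\<close> rescaled to the length of
    \<open>w\<close>. Then \<open>inner y (B w)\<close> is \<open>norm w * norm (B w)\<close>, and
    polarization with the parallelogram law bounds it by
    \<open>\<rho> * (norm w)\<^sup>2\<close>.\<close>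
  define t where "t = norm w / norm (B w)"
  define y where "y = t *\<^sub>R B w"
  have y: "y \<in> W"
    unfolding y_def using W inv w by (simp add: subspace_scale)
  have ny: "norm y = norm w"
    using False by (simp add: y_def t_def)
  have "4 * inner y (B w) = inner (w + y) (B (w + y)) - inner (w - y) (B (w - y))"
    using sym[of y w] by (simp add: B.add B.diff inner_simps)
  also have "\<dots> \<le> \<rho> * (norm (w + y))\<^sup>2 + \<rho> * (norm (w - y))\<^sup>2"
    using bound[of "w + y"] bound[of "w - y"] W w y
    by (auto simp: subspace_add subspace_diff)
  also have "\<dots> = \<rho> * (2 * (norm w)\<^sup>2 + 2 * (norm y)\<^sup>2)"
    by (simp add: power2_norm_eq_inner inner_simps algebra_simps)
  finally have "inner y (B w) \<le> \<rho> * (norm w)\<^sup>2"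
    by (simp add: ny)
  moreover have "inner y (B w) = norm w * norm (B w)"
    using False by (simp add: y_def t_def power2_norm_eq_inner[symmetric] power2_eq_square)
  ultimately have "norm w * norm (B w) \<le> norm w * (\<rho> * norm w)"
    by (simp add: power2_eq_square algebra_simps)
  then show ?thesis
    using False by simp
qed

text \<open>The Rayleigh quotients of \<open>H\<close> on its range lie between \<mu> and L, so
  those of \<open>1 - \<gamma> H\<close> lie between \<open>1 - \<gamma> * L\<close> and
  \<open>1 - \<gamma> * \<mu>\<close>. The range is invariant, so this bound on the form becomes a
  norm bound. The kernel must be left out, because \<open>1 - \<gamma> H\<close> is the identity
  there.\<close>

lemma symmetric_contraction_on_range:
  fixes H :: "'a::real_inner \<Rightarrow> 'a"
  assumes H: "linear H" and sym: "\<And>x y. inner x (H y) = inner y (H x)"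
    and psd: "\<And>x. 0 \<le> inner x (H x)"
    and PL: "\<And>x. \<mu> * inner x (H x) \<le> (norm (H x))\<^sup>2"
    and L: "\<And>x. norm (H x) \<le> L * norm x"
    and "0 < \<mu>" "0 < \<gamma>"
  shows "norm (H x - \<gamma> *\<^sub>R H (H x)) \<le> max \<bar>1 - \<gamma> * \<mu>\<bar> \<bar>1 - \<gamma> * L\<bar> * norm (H x)"
proof -
  interpret H: linear H by fact
  have lower: "\<mu> * (norm (H u))\<^sup>2 \<le> inner (H u) (H (H u))" for u
  proof -
    \<comment> \<open>positivity at \<open>u - H u / \<mu>\<close> plays the role of a square root of \<open>H\<close>\<close>
    have "0 \<le> \<mu>\<^sup>2 * inner (u - (1/\<mu>) *\<^sub>R H u) (H (u - (1/\<mu>) *\<^sub>R H u))"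
      using psd by simp
    also have "\<dots> = \<mu> * (\<mu> * inner u (H u)) - 2 * \<mu> * (norm (H u))\<^sup>2 + inner (H u) (H (H u))"
      using \<open>0 < \<mu>\<close> sym[of u "H u"] unfolding power2_norm_eq_inner
      by (simp add: H.diff H.scale inner_simps field_simps power2_eq_square)
    finally show ?thesis
      using mult_left_mono[OF PL[of u] less_imp_le[OF \<open>0 < \<mu>\<close>]] by linarith
  qed
  have upper: "inner w (H w) \<le> L * (norm w)\<^sup>2" for w
    using norm_cauchy_schwarz[of w "H w"] mult_left_mono[OF L[of w], of "norm w"]
    by (simp add: power2_eq_square algebra_simps)
  let ?B = "\<lambda>x. x - \<gamma> *\<^sub>R H x"
  have "norm (?B (H x)) \<le> max \<bar>1 - \<gamma> * \<mu>\<bar> \<bar>1 - \<gamma> * L\<bar> * norm (H x)"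
  proof (rule symmetric_norm_le_on_subspace[of ?B "range H"])
    show "linear ?B"
      by (rule linearI) (simp_all add: H.add H.scale algebra_simps)
    show "subspace (range H)"
      using linear_subspace_image[OF H subspace_UNIV] .
    show "?B w \<in> range H" if "w \<in> range H" for w
    proof -
      from that obtain u where "w = H u" by auto
      then have "?B w = H (u - \<gamma> *\<^sub>R H u)"
        by (simp add: H.diff H.scale)
      then show ?thesis by blast
    qed
    show "inner x (?B y) = inner y (?B x)" for x y
      using sym[of x y] by (simp add: inner_diff_right inner_commute)
    show "\<bar>inner w (?B w)\<bar> \<le> max \<bar>1 - \<gamma> * \<mu>\<bar> \<bar>1 - \<gamma> * L\<bar> * (norm w)\<^sup>2"
      if "w \<in> range H" for w
    proof -
      let ?\<rho> = "max \<bar>1 - \<gamma> * \<mu>\<bar> \<bar>1 - \<gamma> * L\<bar>"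
      have eq: "inner w (?B w) = (norm w)\<^sup>2 - \<gamma> * inner w (H w)"
        by (simp add: inner_diff_right power2_norm_eq_inner)
      have "\<gamma> * (\<mu> * (norm w)\<^sup>2) \<le> \<gamma> * inner w (H w)" "\<gamma> * inner w (H w) \<le> \<gamma> * (L * (norm w)\<^sup>2)"
        using that lower upper[of w] \<open>0 < \<gamma>\<close> by (auto intro!: mult_left_mono)
      moreover have "(1 - \<gamma> * \<mu>) * (norm w)\<^sup>2 \<le> ?\<rho> * (norm w)\<^sup>2"
        "(- ?\<rho>) * (norm w)\<^sup>2 \<le> (1 - \<gamma> * L) * (norm w)\<^sup>2"
        by (intro mult_right_mono; linarith?; simp)+
      ultimately show ?thesis
        unfolding eq by (simp add: algebra_simps abs_le_iff)
    qed
  qed simp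
  then show ?thesis .
qed

section \<open>The Hessian at a regular point\<close>

lemma GDERIV_along_line:
  assumes "GDERIV f (a + s *\<^sub>R x) :> g"
  shows "((\<lambda>s. f (a + s *\<^sub>R x)) has_real_derivative inner x g) (at s within S)"
proof -
  have "((\<lambda>s. a + s *\<^sub>R x) has_derivative (\<lambda>h. h *\<^sub>R x)) (at s within S)"
    by (auto intro!: derivative_eq_intros)
  from has_derivative_compose[OF this] assms
  have "((\<lambda>s. f (a + s *\<^sub>R x)) has_derivative (\<lambda>h. inner (h *\<^sub>R x) g)) (at s within S)"
    unfolding gderiv_def by blast
  moreover have "(\<lambda>h. inner (h *\<^sub>R x) g) = (*) (inner x g)"
    by (auto simp: mult.commute)
  ultimately show ?thesis
    by (simp add: has_field_derivative_def)
qed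

text \<open>The gradient is the image of \<open>f'\<close> under the fixed linear map from a
  functional to its representing vector, so it inherits differentiability.\<close>

lemma C2_on_grad_differentiable:
  fixes f :: "'a::euclidean_space \<Rightarrow> real"
  assumes C2: "C2_on f U" and "open U" "p \<in> U"
  obtains H where "(grad f has_derivative H) (at p)"
proof -
  from C2 obtain f' :: "'a \<Rightarrow> 'a \<Rightarrow>\<^sub>L real" and f'' where
    f': "\<And>x. x \<in> U \<Longrightarrow> (f has_derivative blinfun_apply (f' x)) (at x)" and
    f'': "(f' has_derivative blinfun_apply (f'' p)) (at p)"
    unfolding C2_on_def C1_on_def using \<open>p \<in> U\<close> by blast
  have eq: "(\<Sum>b\<in>Basis. f' x b *\<^sub>R b) = grad f x" if "x \<in> U" for x
  proof -
    have "blinfun_apply (f' x) = (\<lambda>h. inner h (grad f x))"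
      using has_derivative_unique[OF f'[OF that]] GDERIV_grad[OF f'[OF that]]
      unfolding gderiv_def by blast
    then show ?thesis
      using euclidean_representation[of "grad f x"] by (simp add: inner_commute)
  qed
  have "((\<lambda>x. \<Sum>b\<in>Basis. f' x b *\<^sub>R b) has_derivative (\<lambda>h. \<Sum>b\<in>Basis. f'' p h b *\<^sub>R b)) (at p)"
    by (auto intro!: derivative_eq_intros f'' simp: blinfun.zero_right)
  then show thesis
    using has_derivative_transform_within_open[where g = "grad f", OF _ \<open>open U\<close> \<open>p \<in> U\<close>] eq that by blast
qed

lemma grad_zero_at_local_minimum:
  fixes f :: "'a::euclidean_space \<Rightarrow> real"
  assumes f: "GDERIV f p :> grad f p" and "open U" "p \<in> U" and min: "\<And>x. x \<in> U \<Longrightarrow> f p \<le> f x"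
  shows "grad f p = 0"
proof -
  obtain r where "0 < r" "ball p r \<subseteq> U"
    using \<open>open U\<close> \<open>p \<in> U\<close> open_contains_ball by blast
  then have "(\<lambda>h. inner h (grad f p)) = (\<lambda>h. 0)"
    using differential_zero_maxmin[of p "ball p r" f] f min unfolding gderiv_def
    by (auto simp: subset_eq)
  then have "inner (grad f p) (grad f p) = 0"
    by metis
  then show ?thesis by simp
qed

text \<open>The linearization of the gradient at \<open>p\<close> is carried along the segment from
  \<open>p + y\<close> to \<open>p + y + x\<close>. The base point \<open>p + y\<close> may move
  while \<open>H\<close> stays fixed, so that mixed second differences can be compared.\<close>

lemma second_order_expansion:
  fixes f :: "'a::euclidean_space \<Rightarrow> real"
  assumes f: "\<And>x. x \<in> U \<Longrightarrow> GDERIV f x :> grad f x" and "open U" "p \<in> U"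
    and H: "(grad f has_derivative H) (at p)" and "0 < e"
  obtains d where "0 < d" "\<And>x y. norm x < d \<Longrightarrow> norm y < d \<Longrightarrow>
    \<bar>f (p + y + x) - f (p + y) - inner x (grad f p) - inner x (H y) - inner x (H x) / 2\<bar>
      \<le> e * norm x * (norm x + norm y)"
proof -
  interpret H: bounded_linear H
    using H by (rule has_derivative_bounded_linear)
  obtain r where r: "0 < r" "ball p r \<subseteq> U"
    using \<open>open U\<close> \<open>p \<in> U\<close> open_contains_ball by blast
  obtain d0 where d0: "0 < d0"
    "\<And>y. norm (y - p) < d0 \<Longrightarrow> norm (grad f y - grad f p - H (y - p)) \<le> e * norm (y - p)"
    using H \<open>0 < e\<close> unfolding has_derivative_at_alt by blast
  \<comment> \<open>Halved because the points \<open>y + s *\<^sub>R x\<close> can be as long as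
    \<open>norm x + norm y\<close>.\<close>
  define d where "d = min r d0 / 2"
  show thesis
  proof
    show "0 < d" using r d0 by (simp add: d_def)
    fix x y :: 'a assume x: "norm x < d" and y: "norm y < d"
    \<comment> \<open>\<open>\<phi>\<close> is \<open>f\<close> on the segment minus its quadratic
      model. Its derivative \<open>\<psi>\<close> pairs \<open>x\<close> with the remainder of the
      linearized gradient, and the claim bounds \<open>\<phi> 1 - \<phi> 0\<close>.\<close>
    define \<phi> where "\<phi> s = f (p + y + s *\<^sub>R x) - s * inner x (grad f p) - s * inner x (H y)
       - s\<^sup>2 * inner x (H x) / 2" for s
    define \<psi> where "\<psi> s = inner x (grad f (p + y + s *\<^sub>R x) - grad f p - H (y + s *\<^sub>R x))" for s
    have small: "norm (y + s *\<^sub>R x) \<le> norm x + norm y" "norm (y + s *\<^sub>R x) < min r d0"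
      if "s \<in> {0..1}" for s
    proof -
      have "norm (s *\<^sub>R x) \<le> norm x"
        using that by (simp add: mult_left_le_one_le)
      then show "norm (y + s *\<^sub>R x) \<le> norm x + norm y"
        using norm_triangle_ineq[of y "s *\<^sub>R x"] by linarith
      then show "norm (y + s *\<^sub>R x) < min r d0"
        using x y unfolding d_def by linarith
    qed
    have der: "(\<phi> has_real_derivative \<psi> s) (at s within {0..1})" if "s \<in> {0..1}" for s
    proof -
      have "norm (p - (p + y + s *\<^sub>R x)) < r"
        using small(2)[OF that] norm_minus_cancel[of "y + s *\<^sub>R x"] by (simp add: algebra_simps)
      then have "p + y + s *\<^sub>R x \<in> U"
        using r by (auto simp: dist_norm)
      from GDERIV_along_line[OF f[OF this]] show ?thesis
        unfolding \<phi>_def \<psi>_def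
        by (auto intro!: derivative_eq_intros simp: inner_simps H.add H.scale)
    qed
    have bd: "norm (\<psi> s) \<le> e * norm x * (norm x + norm y)" if "s \<in> {0..1}" for s
    proof -
      have "norm (\<psi> s) \<le> norm x * norm (grad f (p + y + s *\<^sub>R x) - grad f p - H (y + s *\<^sub>R x))"
        unfolding \<psi>_def real_norm_def by (rule Cauchy_Schwarz_ineq2)
      also have "\<dots> \<le> norm x * (e * norm (y + s *\<^sub>R x))"
        using d0(2)[of "p + y + s *\<^sub>R x"] small(2)[OF that]
        by (intro mult_left_mono) (auto simp: algebra_simps)
      also have "\<dots> \<le> norm x * (e * (norm x + norm y))"
        using small(1)[OF that] \<open>0 < e\<close> by (intro mult_left_mono) auto
      finally show ?thesis by (simp add: algebra_simps)
    qed
    have "norm (\<phi> 1 - \<phi> 0) \<le> e * norm x * (norm x + norm y) * norm (1 - 0 :: real)"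
      by (rule field_differentiable_bound[OF _ der bd]) auto
    then show "\<bar>f (p + y + x) - f (p + y) - inner x (grad f p) - inner x (H y) - inner x (H x) / 2\<bar>
      \<le> e * norm x * (norm x + norm y)"
      by (simp add: \<phi>_def algebra_simps)
  qed
qed

text \<open>Removes the Taylor remainders: the inequalities below hold up to \<open>e * c\<close>,
  at a scale that depends on \<open>e\<close>. Having \<open>e < 1\<close> allows
  \<open>e\<^sup>2\<close> to be absorbed into \<open>e\<close>.\<close>

lemma nonneg_if_ge_neg_multiple:
  fixes a c :: real
  assumes "\<And>e. 0 < e \<Longrightarrow> e < 1 \<Longrightarrow> - (e * c) \<le> a"
  shows "0 \<le> a"
proof (rule ccontr)
  assume "\<not> 0 \<le> a"
  then have a: "a < 0" by simp
  \<comment> \<open>The second entry makes \<open>e * \<bar>c\<bar>\<close> at most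
    \<open>- a / 2\<close>, too small for the assumed inequality. The added 1 covers
    \<open>c = 0\<close>.\<close>
  define e where "e = min (1/2) (- a / (2 * (\<bar>c\<bar> + 1)))"
  have e: "0 < e" "e < 1"
    using a by (auto simp: e_def intro!: divide_neg_pos)
  have "0 < \<bar>c\<bar> + 1"
    by simp
  have "0 \<le> - a / (2 * (\<bar>c\<bar> + 1))"
    using a by (intro divide_nonneg_pos) auto
  then have "e * \<bar>c\<bar> \<le> - a / (2 * (\<bar>c\<bar> + 1)) * (\<bar>c\<bar> + 1)"
    unfolding e_def by (intro mult_mono) auto
  also have "\<dots> = - a / 2"
    using \<open>0 < \<bar>c\<bar> + 1\<close> by (simp only: times_divide_eq_left mult_divide_mult_cancel_right less_imp_neq[symmetric] simp_thms)
  finally have "e * \<bar>c\<bar> \<le> - a / 2" .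
  moreover have "e * c \<le> e * \<bar>c\<bar>"
    using e by (intro mult_left_mono) auto
  ultimately show False
    using assms[OF e] a by linarith
qed

text \<open>The difference \<open>f (p + t u + t v) - f (p + t u) - f (p + t v) + f p\<close> is symmetric in
  \<open>u\<close> and \<open>v\<close>, and to second order it equals \<open>t\<^sup>2 (u \<bullet> H v)\<close>.\<close>

lemma second_derivative_symmetric:
  fixes f :: "'a::euclidean_space \<Rightarrow> real"
  assumes f: "\<And>x. x \<in> U \<Longrightarrow> GDERIV f x :> grad f x" and "open U" "p \<in> U"
    and H: "(grad f has_derivative H) (at p)"
  shows "inner u (H v) = inner v (H u)"
proof -
  interpret H: bounded_linear H
    using H by (rule has_derivative_bounded_linear)
  have *: "inner v (H u) \<le> inner u (H v)" for u v
  proof -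
    \<comment> \<open>The sum of the four remainder bounds below, with the common factor
      \<open>t\<^sup>2 * e\<close> taken out.\<close>
    let ?c = "norm u * (norm u + norm v) + (norm u)\<^sup>2 + norm v * (norm u + norm v) + (norm v)\<^sup>2"
    have "- (e * ?c) \<le> inner u (H v) - inner v (H u)" if "0 < e" for e
    proof -
      obtain d where d: "0 < d" "\<And>x y. norm x < d \<Longrightarrow> norm y < d \<Longrightarrow>
        \<bar>f (p + y + x) - f (p + y) - inner x (grad f p) - inner x (H y) - inner x (H x) / 2\<bar>
          \<le> e * norm x * (norm x + norm y)"
        using second_order_expansion[OF f \<open>open U\<close> \<open>p \<in> U\<close> H \<open>0 < e\<close>] by blast
      define t where "t = d / (norm u + norm v + 1)"
      have den: "0 < norm u + norm v + 1"
        by (smt (verit) norm_ge_zero)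
      then have t: "0 < t" using d by (simp add: t_def)
      have td: "t * (norm u + norm v + 1) = d"
        using den by (simp add: t_def)
      have "0 \<le> t * norm u" "0 \<le> t * norm v"
        using t by auto
      then have small: "norm (t *\<^sub>R u) < d" "norm (t *\<^sub>R v) < d"
        using td t unfolding distrib_left norm_scaleR abs_of_pos[OF t] by linarith+
      define a b where "a = inner u (H v)" and "b = inner v (H u)"
      define A where "A = f (p + t *\<^sub>R u + t *\<^sub>R v)"
      have A: "f (p + t *\<^sub>R v + t *\<^sub>R u) = A"
        by (simp add: A_def algebra_simps)
      \<comment> \<open>The mixed difference is expanded in two ways. Subtracting 2 from 1 gives
        \<open>t\<^sup>2 * a\<close> and subtracting 4 from 3 gives \<open>t\<^sup>2 * b\<close>;
        within each pair the gradient term and the diagonal Hessian term cancel.\<close>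
      have 1: "\<bar>A - f (p + t *\<^sub>R v) - t * inner u (grad f p) - t\<^sup>2 * a - t\<^sup>2 * inner u (H u) / 2\<bar>
          \<le> t\<^sup>2 * (e * (norm u * (norm u + norm v)))"
        using d(2)[OF small] t unfolding A a_def
        by (simp add: H.scale power2_eq_square algebra_simps)
      have 2: "\<bar>f (p + t *\<^sub>R u) - f p - t * inner u (grad f p) - t\<^sup>2 * inner u (H u) / 2\<bar>
          \<le> t\<^sup>2 * (e * (norm u)\<^sup>2)"
        using d(2)[OF small(1), of 0] t d(1)
        by (simp add: H.zero H.scale power2_eq_square algebra_simps)
      have 3: "\<bar>A - f (p + t *\<^sub>R u) - t * inner v (grad f p) - t\<^sup>2 * b - t\<^sup>2 * inner v (H v) / 2\<bar>
          \<le> t\<^sup>2 * (e * (norm v * (norm u + norm v)))"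
        using d(2)[OF small(2,1)] t unfolding A_def[symmetric] b_def
        by (simp add: H.scale power2_eq_square algebra_simps)
      have 4: "\<bar>f (p + t *\<^sub>R v) - f p - t * inner v (grad f p) - t\<^sup>2 * inner v (H v) / 2\<bar>
          \<le> t\<^sup>2 * (e * (norm v)\<^sup>2)"
        using d(2)[OF small(2), of 0] t d(1)
        by (simp add: H.zero H.scale power2_eq_square algebra_simps)
      have "t\<^sup>2 * (b - a) \<le> t\<^sup>2 * (e * ?c)"
        using 1 2 3 4 unfolding abs_le_iff distrib_left right_diff_distrib by linarith
      then have "b - a \<le> e * ?c"
        using t by simp
      then show ?thesis by (simp add: a_def b_def)
    qed
    then have "0 \<le> inner u (H v) - inner v (H u)"
      by (intro nonneg_if_ge_neg_multiple)
    then show ?thesis by simp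
  qed
  show ?thesis
    using *[of u v] *[of v u] by simp
qed

text \<open>Each bound is an assumption on \<open>f\<close> evaluated at
  \<open>p + t *\<^sub>R v\<close> and divided by \<open>t\<^sup>2\<close>, or by \<open>t\<close>
  for the Lipschitz bound. The gradient vanishes at \<open>p\<close>, so the Hessian terms lead, and
  the relative errors of order \<open>e\<close> are sent to zero.\<close>

lemma hessian_at_minimum_of_PL_function:
  fixes f :: "'a::euclidean_space \<Rightarrow> real"
  assumes f: "\<And>x. x \<in> U \<Longrightarrow> GDERIV f x :> grad f x" and U: "open U" "p \<in> U"
    and H: "(grad f has_derivative H) (at p)" and "0 < \<mu>"
    and min: "\<And>x. x \<in> U \<Longrightarrow> f p \<le> f x"
    and PL: "\<And>x. x \<in> U \<Longrightarrow> 2 * \<mu> * (f x - f p) \<le> (norm (grad f x))\<^sup>2"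
    and Lip: "\<And>x y. x \<in> U \<Longrightarrow> y \<in> U \<Longrightarrow> norm (grad f x - grad f y) \<le> L * norm (x - y)"
  shows "0 \<le> inner v (H v)" "\<mu> * inner v (H v) \<le> (norm (H v))\<^sup>2" "norm (H v) \<le> L * norm v"
proof -
  interpret H: bounded_linear H
    using H by (rule has_derivative_bounded_linear)
  have g0: "grad f p = 0"
    using grad_zero_at_local_minimum[OF f U] U min by blast
  \<comment> \<open>One \<open>t\<close> serves the expansions of both \<open>f\<close> and its
    gradient, since the Polyak--Lojasiewicz inequality compares them at the same point.\<close>
  have approx: "\<exists>t>0. p + t *\<^sub>R v \<in> U \<and>
      \<bar>f (p + t *\<^sub>R v) - f p - t\<^sup>2 * inner v (H v) / 2\<bar> \<le> t\<^sup>2 * (e * (norm v)\<^sup>2) \<and>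
      norm (grad f (p + t *\<^sub>R v) - t *\<^sub>R H v) \<le> t * (e * norm v)" if "0 < e" for e
  proof -
    obtain d1 where d1: "0 < d1" "\<And>x y. norm x < d1 \<Longrightarrow> norm y < d1 \<Longrightarrow>
      \<bar>f (p + y + x) - f (p + y) - inner x (grad f p) - inner x (H y) - inner x (H x) / 2\<bar>
        \<le> e * norm x * (norm x + norm y)"
      using second_order_expansion[OF f U H \<open>0 < e\<close>] by blast
    obtain d2 where d2: "0 < d2"
      "\<And>y. norm (y - p) < d2 \<Longrightarrow> norm (grad f y - grad f p - H (y - p)) \<le> e * norm (y - p)"
      using H \<open>0 < e\<close> unfolding has_derivative_at_alt by blast
    obtain r where r: "0 < r" "ball p r \<subseteq> U"
      using U open_contains_ball by blast
    define d where "d = min r (min d1 d2)"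
    have "0 < d" using d1 d2 r by (simp add: d_def)
    define t where "t = d / (norm v + 1)"
    have den: "0 < norm v + 1"
      by (smt (verit) norm_ge_zero)
    then have t: "0 < t" using \<open>0 < d\<close> by (simp add: t_def)
    have "t * (norm v + 1) = d"
      using den by (simp add: t_def)
    then have small: "norm (t *\<^sub>R v) < d"
      using t by (simp add: algebra_simps)
    have "p + t *\<^sub>R v \<in> U"
      using small r by (auto simp: dist_norm d_def)
    moreover have "\<bar>f (p + t *\<^sub>R v) - f p - t\<^sup>2 * inner v (H v) / 2\<bar> \<le> t\<^sup>2 * (e * (norm v)\<^sup>2)"
      using d1(2)[of "t *\<^sub>R v" 0] small t d1(1)
      by (simp add: d_def g0 H.zero H.scale power2_eq_square algebra_simps)
    moreover have "norm (grad f (p + t *\<^sub>R v) - t *\<^sub>R H v) \<le> t * (e * norm v)"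
      using d2(2)[of "p + t *\<^sub>R v"] small t
      by (simp add: d_def g0 H.scale algebra_simps)
    ultimately show ?thesis using t by blast
  qed
  have "- (e * (2 * (norm v)\<^sup>2)) \<le> inner v (H v)" if "0 < e" for e
  proof -
    from approx[OF that] obtain t where t: "0 < t" "p + t *\<^sub>R v \<in> U"
      "\<bar>f (p + t *\<^sub>R v) - f p - t\<^sup>2 * inner v (H v) / 2\<bar> \<le> t\<^sup>2 * (e * (norm v)\<^sup>2)" by blast
    have "t\<^sup>2 * (- (e * (2 * (norm v)\<^sup>2))) \<le> t\<^sup>2 * inner v (H v)"
      using t(3) min[OF t(2)] by (simp add: abs_le_iff)
    then show ?thesis using t(1) by (meson mult_le_cancel_left_pos zero_less_power)
  qed
  then show "0 \<le> inner v (H v)"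
    by (rule nonneg_if_ge_neg_multiple)
  \<comment> \<open>The error comes from squaring \<open>norm (H v) + e * norm v\<close>, with
    \<open>e\<^sup>2\<close> replaced by \<open>e\<close>, and from the remainder of
    \<open>f\<close> multiplied by \<open>2 * \<mu>\<close>.\<close>
  have "- (e * (norm v * (2 * norm (H v) + norm v) + 2 * \<mu> * (norm v)\<^sup>2))
      \<le> (norm (H v))\<^sup>2 - \<mu> * inner v (H v)" if e: "0 < e" "e < 1" for e
  proof -
    from approx[OF e(1)] obtain t where t: "0 < t" "p + t *\<^sub>R v \<in> U"
      "\<bar>f (p + t *\<^sub>R v) - f p - t\<^sup>2 * inner v (H v) / 2\<bar> \<le> t\<^sup>2 * (e * (norm v)\<^sup>2)"
      "norm (grad f (p + t *\<^sub>R v) - t *\<^sub>R H v) \<le> t * (e * norm v)" by blast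
    have "norm (grad f (p + t *\<^sub>R v)) \<le> t * norm (H v) + t * (e * norm v)"
      using t(4) norm_triangle_sub[of "grad f (p + t *\<^sub>R v)" "t *\<^sub>R H v"] t(1) by simp
    then have "(norm (grad f (p + t *\<^sub>R v)))\<^sup>2 \<le> (t * (norm (H v) + e * norm v))\<^sup>2"
      by (intro power_mono) (auto simp: algebra_simps)
    then have "(norm (grad f (p + t *\<^sub>R v)))\<^sup>2 \<le> t\<^sup>2 * (norm (H v) + e * norm v)\<^sup>2"
      by (simp only: power_mult_distrib)
    moreover have "2 * \<mu> * (t\<^sup>2 * inner v (H v) / 2 - t\<^sup>2 * (e * (norm v)\<^sup>2))
        \<le> 2 * \<mu> * (f (p + t *\<^sub>R v) - f p)"
      using t(3) \<open>0 < \<mu>\<close> by (intro mult_left_mono) (auto simp: abs_le_iff)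
    ultimately have "t\<^sup>2 * (\<mu> * inner v (H v) - 2 * \<mu> * e * (norm v)\<^sup>2)
        \<le> t\<^sup>2 * (norm (H v) + e * norm v)\<^sup>2"
      using PL[OF t(2)] by (simp add: algebra_simps)
    then have 1: "\<mu> * inner v (H v) - 2 * \<mu> * e * (norm v)\<^sup>2 \<le> (norm (H v) + e * norm v)\<^sup>2"
      using t(1) by simp
    have "e * (e * (norm v)\<^sup>2) \<le> e * (norm v)\<^sup>2"
      using e by (intro mult_left_mono mult_left_le_one_le) auto
    with 1 show ?thesis
      by (simp add: power2_eq_square algebra_simps)
  qed
  then have "0 \<le> (norm (H v))\<^sup>2 - \<mu> * inner v (H v)"
    by (rule nonneg_if_ge_neg_multiple)
  then show "\<mu> * inner v (H v) \<le> (norm (H v))\<^sup>2" by simp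
  have "- (e * norm v) \<le> L * norm v - norm (H v)" if "0 < e" for e
  proof -
    from approx[OF that] obtain t where t: "0 < t" "p + t *\<^sub>R v \<in> U"
      "norm (grad f (p + t *\<^sub>R v) - t *\<^sub>R H v) \<le> t * (e * norm v)" by blast
    have "norm (t *\<^sub>R H v) \<le> norm (grad f (p + t *\<^sub>R v)) + t * (e * norm v)"
      using t(3) norm_triangle_sub[of "t *\<^sub>R H v" "grad f (p + t *\<^sub>R v)"]
      by (simp add: norm_minus_commute)
    moreover have "norm (grad f (p + t *\<^sub>R v)) \<le> L * (t * norm v)"
      using Lip[OF t(2) U(2)] t(1) by (simp add: g0)
    ultimately have "t * norm (H v) \<le> t * (L * norm v + e * norm v)"
      using t(1) by (simp add: algebra_simps)
    then show ?thesis using t(1) by simp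
  qed
  then have "0 \<le> L * norm v - norm (H v)"
    by (rule nonneg_if_ge_neg_multiple)
  then show "norm (H v) \<le> L * norm v" by simp
qed

section \<open>Convergence of gradient descent\<close>

text \<open>Along the segment, \<open>f\<close> minus its quadratic upper model has nonpositive
  derivative, by Cauchy--Schwarz and the Lipschitz bound. Convexity keeps the segment in
  \<open>U\<close>.\<close>

lemma descent_lemma:
  fixes f :: "'a::euclidean_space \<Rightarrow> real"
  assumes "convex U" and f: "\<And>x. x \<in> U \<Longrightarrow> GDERIV f x :> grad f x"
    and Lip: "\<And>x y. x \<in> U \<Longrightarrow> y \<in> U \<Longrightarrow> norm (grad f x - grad f y) \<le> L * norm (x - y)"
    and x: "x \<in> U" and y: "x + h \<in> U"
  shows "f (x + h) \<le> f x + inner h (grad f x) + L / 2 * (norm h)\<^sup>2"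
proof -
  define \<phi> where "\<phi> s = f (x + s *\<^sub>R h) - s * inner h (grad f x) - L / 2 * s\<^sup>2 * (norm h)\<^sup>2" for s
  have "\<phi> 1 \<le> \<phi> 0"
  proof (rule DERIV_nonpos_imp_nonincreasing[of 0 1 \<phi>])
    fix s :: real assume s: "0 \<le> s" "s \<le> 1"
    have "(1 - s) *\<^sub>R x + s *\<^sub>R (x + h) \<in> U"
      using \<open>convex U\<close> x y s by (simp add: convex_alt)
    then have U: "x + s *\<^sub>R h \<in> U"
      by (simp add: algebra_simps)
    have "(\<phi> has_real_derivative
        inner h (grad f (x + s *\<^sub>R h)) - inner h (grad f x) - L * s * (norm h)\<^sup>2) (at s)"
      unfolding \<phi>_def
      by (rule derivative_eq_intros GDERIV_along_line[OF f[OF U]] refl)+ simp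
    moreover have "inner h (grad f (x + s *\<^sub>R h)) - inner h (grad f x) \<le> L * s * (norm h)\<^sup>2"
    proof -
      have "inner h (grad f (x + s *\<^sub>R h) - grad f x)
          \<le> norm h * norm (grad f (x + s *\<^sub>R h) - grad f x)"
        by (rule norm_cauchy_schwarz)
      also have "\<dots> \<le> norm h * (L * (s * norm h))"
        using Lip[OF U x] s by (intro mult_left_mono) auto
      finally show ?thesis
        by (simp add: inner_diff_right power2_eq_square algebra_simps)
    qed
    ultimately show "\<exists>y. (\<phi> has_real_derivative y) (at s) \<and> y \<le> 0"
      by force
  qed simp
  then show ?thesis by (simp add: \<phi>_def)
qed

text \<open>A potential whose decrease pays for each step pays for the whole displacement. Only
  steps before \<open>n\<close> are assumed to be paid for, so the bound can be used while
  membership in a ball is still being proved by induction.\<close>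

lemma norm_diff_le_telescope:
  fixes x :: "nat \<Rightarrow> 'a::real_normed_vector" and s :: "nat \<Rightarrow> real"
  assumes "\<And>k. k < n \<Longrightarrow> norm (x (Suc k) - x k) \<le> s k - s (Suc k)" and "m \<le> n"
  shows "norm (x n - x m) \<le> s m - s n"
  using \<open>m \<le> n\<close> assms(1)
proof (induction n rule: dec_induct)
  case (step n)
  have "norm (x (Suc n) - x m) \<le> norm (x (Suc n) - x n) + norm (x n - x m)"
    using norm_triangle_ineq[of "x (Suc n) - x n" "x n - x m"] by simp
  with step.IH step.prems[of n] step.prems show ?case
    by fastforce
qed simp


text \<open>By the descent lemma one step lowers \<open>f\<close> by at least
  \<open>c * (norm g)\<^sup>2\<close>. The Polyak--Lojasiewicz inequality turns this into a
  contraction of the root of the gap by \<open>\<sigma>\<close>, while nonnegativity of the new gap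
  bounds \<open>norm g\<close> by a multiple of the old root. Since the root loses at least the
  fraction \<open>1 - \<sigma>\<close>, this loss pays for the step.\<close>

lemma gradient_step_PL:
  fixes f :: "'a::euclidean_space \<Rightarrow> real"
  assumes \<mu>: "0 < \<mu>" "\<mu> \<le> L" and \<gamma>: "0 < \<gamma>" "\<gamma> < 2 / L"
    and f: "\<And>x. x \<in> ball p (3 * r) \<Longrightarrow> GDERIV f x :> grad f x"
    and min: "\<And>x. x \<in> ball p (3 * r) \<Longrightarrow> f p \<le> f x"
    and PL: "\<And>x. x \<in> ball p (3 * r) \<Longrightarrow> 2 * \<mu> * (f x - f p) \<le> (norm (grad f x))\<^sup>2"
    and Lip: "\<And>x y. x \<in> ball p (3 * r) \<Longrightarrow> y \<in> ball p (3 * r) \<Longrightarrow>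
      norm (grad f x - grad f y) \<le> L * norm (x - y)"
  obtains B \<sigma> where "0 < B" "0 \<le> \<sigma>" "\<sigma> < 1"
    "\<And>x. x \<in> ball p r \<Longrightarrow> sqrt (f (x - \<gamma> *\<^sub>R grad f x) - f p) \<le> \<sigma> * sqrt (f x - f p)"
    "\<And>x. x \<in> ball p r \<Longrightarrow> norm (\<gamma> *\<^sub>R grad f x)
        \<le> B * (sqrt (f x - f p) - sqrt (f (x - \<gamma> *\<^sub>R grad f x) - f p))"
    "\<And>x. x \<in> ball p r \<Longrightarrow> f p \<le> f (x - \<gamma> *\<^sub>R grad f x)"
proof -
  have "0 < L" using \<mu> by simp
  have \<gamma>L: "\<gamma> * L < 2"
    using \<gamma> \<open>0 < L\<close> by (simp add: field_simps)
  define c where "c = \<gamma> * (1 - L * \<gamma> / 2)"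
  have c: "0 < c"
    using \<gamma> \<gamma>L by (auto simp: c_def field_simps)
  \<comment> \<open>Completing the square shows that \<open>1 - 2 * \<mu> * c\<close> is
    nonnegative, so \<open>\<sigma>\<close> is a genuine square root.\<close>
  have "2 * L * c = 1 - (1 - L * \<gamma>)\<^sup>2"
    by (simp add: c_def power2_eq_square algebra_simps)
  then have "2 * L * c \<le> 1"
    by simp
  moreover have "2 * \<mu> * c \<le> 2 * L * c"
    using \<mu> c by simp
  ultimately have q: "0 \<le> 1 - 2 * \<mu> * c"
    by linarith
  define \<sigma> where "\<sigma> = sqrt (1 - 2 * \<mu> * c)"
  have \<sigma>: "0 \<le> \<sigma>" "\<sigma> < 1"
    using q \<mu> c by (auto simp: \<sigma>_def)
  \<comment> \<open>\<open>\<gamma> / sqrt c\<close> bounds the step by the root of the gap;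
    dividing by \<open>1 - \<sigma>\<close> bounds it by the decrease of that root.\<close>
  define B where "B = \<gamma> / (sqrt c * (1 - \<sigma>))"
  have B: "0 < B"
    using \<gamma> c \<sigma> by (auto simp: B_def)
  have *: "sqrt (f (x - \<gamma> *\<^sub>R grad f x) - f p) \<le> \<sigma> * sqrt (f x - f p) \<and>
      norm (\<gamma> *\<^sub>R grad f x) \<le> B * (sqrt (f x - f p) - sqrt (f (x - \<gamma> *\<^sub>R grad f x) - f p)) \<and>
      f p \<le> f (x - \<gamma> *\<^sub>R grad f x)"
    if x: "x \<in> ball p r" for x
  proof -
    define g y where "g = grad f x" and "y = x - \<gamma> *\<^sub>R g"
    have xr: "norm (x - p) < r"
      using x by (simp add: dist_norm norm_minus_commute)
    then have "0 < r"
      using norm_ge_zero[of "x - p"] by linarith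
    then have p3: "p \<in> ball p (3 * r)" and x3: "x \<in> ball p (3 * r)"
      using x by auto
    have g0: "grad f p = 0"
      using grad_zero_at_local_minimum[OF f[OF p3] _ p3] min by blast
    \<comment> \<open>The gradient vanishes at \<open>p\<close> and \<open>\<gamma> * L < 2\<close>,
      so a step at most triples the distance to \<open>p\<close>. This explains the radius
      \<open>3 * r\<close>.\<close>
    have "\<gamma> * norm g \<le> \<gamma> * (L * norm (x - p))"
      using Lip[OF x3 p3] \<gamma> by (intro mult_left_mono) (auto simp: g_def g0)
    also have "\<dots> \<le> 2 * norm (x - p)"
      using mult_right_mono[OF less_imp_le[OF \<gamma>L] norm_ge_zero[of "x - p"]] by simp
    finally have "norm (y - p) \<le> 3 * norm (x - p)"
      using norm_triangle_ineq4[of "x - p" "\<gamma> *\<^sub>R g"] \<gamma> by (simp add: y_def algebra_simps)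
    then have y3: "y \<in> ball p (3 * r)"
      using xr by (simp add: dist_norm norm_minus_commute)
    have "f (x + - (\<gamma> *\<^sub>R g)) \<le> f x + inner (- (\<gamma> *\<^sub>R g)) (grad f x) + L / 2 * (norm (- (\<gamma> *\<^sub>R g)))\<^sup>2"
      using y3 by (intro descent_lemma[OF _ f Lip x3]) (auto simp: y_def)
    then have desc: "f y \<le> f x - c * (norm g)\<^sup>2"
      by (simp add: y_def c_def power_mult_distrib power2_eq_square algebra_simps
          flip: g_def power2_norm_eq_inner)
    have "c * (2 * \<mu> * (f x - f p)) \<le> c * (norm g)\<^sup>2"
      using PL[OF x3] c by (simp add: g_def)
    with desc have "f y - f p \<le> (1 - 2 * \<mu> * c) * (f x - f p)"
      by (simp add: algebra_simps)
    then have 1: "sqrt (f y - f p) \<le> \<sigma> * sqrt (f x - f p)"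
      unfolding \<sigma>_def by (simp flip: real_sqrt_mult)
    have "c * (norm g)\<^sup>2 \<le> f x - f p"
      using desc min[OF y3] by simp
    then have "sqrt (c * (norm g)\<^sup>2) \<le> sqrt (f x - f p)"
      by (rule real_sqrt_le_mono)
    then have "sqrt c * norm g \<le> sqrt (f x - f p)"
      by (simp add: real_sqrt_mult)
    then have "\<gamma> * norm g \<le> \<gamma> / sqrt c * sqrt (f x - f p)"
      using \<gamma> c by (simp add: field_simps)
    also have "\<dots> = B * ((1 - \<sigma>) * sqrt (f x - f p))"
      using \<sigma> by (simp add: B_def)
    also have "\<dots> \<le> B * (sqrt (f x - f p) - sqrt (f y - f p))"
      using 1 B by (intro mult_left_mono) (auto simp: algebra_simps)
    finally show ?thesis
      using 1 \<gamma> min[OF y3] by (simp add: y_def g_def)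
  qed
  show thesis
    using that[OF B \<sigma>] * by blast
qed

text \<open>The displacement from the start is at most \<open>B\<close> times the initial root of
  the gap, so the start condition traps the iterates in the ball. The root then decays geometrically
  and makes the sequence Cauchy. The same bound from an arbitrary index \<open>k\<close> controls
  the distance to the limit.\<close>

lemma gradient_descent_PL_converges:
  fixes f :: "'a::euclidean_space \<Rightarrow> real"
  assumes \<mu>: "0 < \<mu>" "\<mu> \<le> L" and \<gamma>: "0 < \<gamma>" "\<gamma> < 2 / L"
    and f: "\<And>x. x \<in> ball p (3 * r) \<Longrightarrow> GDERIV f x :> grad f x"
    and min: "\<And>x. x \<in> ball p (3 * r) \<Longrightarrow> f p \<le> f x"
    and PL: "\<And>x. x \<in> ball p (3 * r) \<Longrightarrow> 2 * \<mu> * (f x - f p) \<le> (norm (grad f x))\<^sup>2"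
    and Lip: "\<And>x y. x \<in> ball p (3 * r) \<Longrightarrow> y \<in> ball p (3 * r) \<Longrightarrow>
      norm (grad f x - grad f y) \<le> L * norm (x - y)"
  obtains B where "0 < B"
    "\<And>\<theta>. gradient_descent f \<gamma> \<theta> \<Longrightarrow> \<theta> 0 \<in> ball p r \<Longrightarrow>
      norm (\<theta> 0 - p) + B * sqrt (f (\<theta> 0) - f p) < r \<Longrightarrow>
      \<exists>q \<in> ball p r. \<theta> \<longlonglongrightarrow> q \<and> f q = f p \<and>
        (\<forall>k. \<theta> k \<in> ball p r \<and> norm (\<theta> k - q) \<le> B * sqrt (f (\<theta> k) - f p))"
proof -
  obtain B \<sigma> where B: "0 < B" and \<sigma>: "0 \<le> \<sigma>" "\<sigma> < 1" and
    shrink: "\<And>x. x \<in> ball p r \<Longrightarrow> sqrt (f (x - \<gamma> *\<^sub>R grad f x) - f p) \<le> \<sigma> * sqrt (f x - f p)" and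
    step: "\<And>x. x \<in> ball p r \<Longrightarrow> norm (\<gamma> *\<^sub>R grad f x)
        \<le> B * (sqrt (f x - f p) - sqrt (f (x - \<gamma> *\<^sub>R grad f x) - f p))" and
    above: "\<And>x. x \<in> ball p r \<Longrightarrow> f p \<le> f (x - \<gamma> *\<^sub>R grad f x)"
    using gradient_step_PL[OF \<mu> \<gamma> f min PL Lip] by blast
  have "\<exists>q \<in> ball p r. \<theta> \<longlonglongrightarrow> q \<and> f q = f p \<and>
      (\<forall>k. \<theta> k \<in> ball p r \<and> norm (\<theta> k - q) \<le> B * sqrt (f (\<theta> k) - f p))"
    if gd: "gradient_descent f \<gamma> \<theta>" and start: "\<theta> 0 \<in> ball p r"
      "norm (\<theta> 0 - p) + B * sqrt (f (\<theta> 0) - f p) < r" for \<theta>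
  proof -
    define s where "s k = sqrt (f (\<theta> k) - f p)" for k
    have Suc: "\<theta> (Suc k) = \<theta> k - \<gamma> *\<^sub>R grad f (\<theta> k)" for k
      using gd by (simp add: gradient_descent_def)
    have step': "norm (\<theta> (Suc k) - \<theta> k) \<le> B * s k - B * s (Suc k)" if "\<theta> k \<in> ball p r" for k
      using step[OF that] unfolding s_def Suc by (simp add: right_diff_distrib)
    have near: "x \<in> ball p (3 * r)" if "x \<in> ball p r" for x
    proof -
      have "dist p x < r" using that by simp
      then show ?thesis using zero_le_dist[of p x] unfolding mem_ball by linarith
    qed
    \<comment> \<open>Strong induction, as telescoping needs all earlier iterates in the ball. For
      the new iterate \<open>s k\<close> is nonnegative by \<open>above\<close>, applied to its
      predecessor.\<close>
    have in_ball: "\<theta> k \<in> ball p r" for k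
    proof (induction k rule: less_induct)
      case (less k)
      show ?case
      proof (cases k)
        case (Suc m)
        have "norm (\<theta> k - \<theta> 0) \<le> B * s 0 - B * s k"
          by (rule norm_diff_le_telescope[of _ _ "\<lambda>k. B * s k"]) (auto intro: step' less)
        moreover have "0 \<le> s k"
          using above[OF less[of m]] by (simp add: Suc s_def \<open>\<theta> (Suc m) = _\<close>)
        ultimately have "norm (\<theta> k - \<theta> 0) \<le> B * s 0"
          using B by (smt (verit) mult_nonneg_nonneg)
        then have "norm (\<theta> k - p) < r"
          using start(2) norm_triangle_ineq[of "\<theta> k - \<theta> 0" "\<theta> 0 - p"] by (simp add: s_def)
        then show ?thesis
          by (simp add: dist_norm norm_minus_commute)
      qed (use start in simp)
    qed
    have s0: "0 \<le> s k" for k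
      using min[OF near[OF in_ball]] by (simp add: s_def)
    have tail: "norm (\<theta> n - \<theta> m) \<le> B * s m" if "m \<le> n" for m n
      using norm_diff_le_telescope[of n \<theta> "\<lambda>k. B * s k" m, OF step'[OF in_ball] that]
        mult_nonneg_nonneg[of B "s n"] s0[of n] B by linarith
    have "s k \<le> \<sigma> ^ k * s 0" for k
    proof (induction k)
      case (Suc k)
      have "s (Suc k) \<le> \<sigma> * s k"
        using shrink[OF in_ball[of k]] by (simp add: s_def \<open>\<theta> (Suc _) = _\<close>)
      also have "\<dots> \<le> \<sigma> * (\<sigma> ^ k * s 0)"
        using Suc \<sigma> by (intro mult_left_mono)
      finally show ?case by simp
    qed simp
    moreover have "(\<lambda>k. \<sigma> ^ k * s 0) \<longlonglongrightarrow> 0"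
      using \<sigma> by (intro tendsto_mult_left_zero LIMSEQ_power_zero) auto
    ultimately have s_lim: "s \<longlonglongrightarrow> 0"
      using s0 by (intro tendsto_sandwich[of "\<lambda>_. 0" s _ "\<lambda>k. \<sigma> ^ k * s 0"]) auto
    have "Cauchy \<theta>"
    proof (rule CauchyI')
      fix e :: real assume "0 < e"
      have "\<forall>\<^sub>F k in sequentially. B * s k < e"
        using tendsto_mult_right_zero[OF s_lim] \<open>0 < e\<close> by (rule order_tendstoD(2))
      then obtain M where M: "\<And>m. m \<ge> M \<Longrightarrow> B * s m < e"
        unfolding eventually_sequentially by blast
      have "dist (\<theta> m) (\<theta> n) < e" if "m \<ge> M" "n > m" for m n
        using tail[of m n] M[OF that(1)] that(2) by (simp add: dist_norm norm_minus_commute)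
      then show "\<exists>M. \<forall>m\<ge>M. \<forall>n>m. dist (\<theta> m) (\<theta> n) < e" by blast
    qed
    then obtain q where q: "\<theta> \<longlonglongrightarrow> q"
      using Cauchy_convergent convergent_def by blast
    have dist_q: "norm (\<theta> k - q) \<le> B * s k" for k
    proof -
      have "(\<lambda>n. norm (\<theta> n - \<theta> k)) \<longlonglongrightarrow> norm (q - \<theta> k)"
        by (intro tendsto_intros q)
      then have "norm (q - \<theta> k) \<le> B * s k"
        by (rule LIMSEQ_le_const2) (use tail in blast)
      then show ?thesis by (simp add: norm_minus_commute)
    qed
    have "norm (q - p) < r"
      using dist_q[of 0] start(2) norm_triangle_ineq[of "q - \<theta> 0" "\<theta> 0 - p"]
      by (simp add: s_def norm_minus_commute)
    then have q_ball: "q \<in> ball p r"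
      by (simp add: dist_norm norm_minus_commute)
    \<comment> \<open>The limit of \<open>f (\<theta> k)\<close> is computed twice: by continuity at
      \<open>q\<close>, and from \<open>s\<close> tending to zero.\<close>
    have "isCont f q"
      using f[OF near[OF q_ball]] unfolding gderiv_def by (rule has_derivative_continuous)
    then have "(\<lambda>k. f (\<theta> k)) \<longlonglongrightarrow> f q"
      using q isCont_tendsto_compose by blast
    moreover have "(\<lambda>k. (s k)\<^sup>2 + f p) \<longlonglongrightarrow> 0\<^sup>2 + f p"
      by (intro tendsto_intros s_lim)
    then have "(\<lambda>k. f (\<theta> k)) \<longlonglongrightarrow> f p"
      using min[OF near[OF in_ball]] by (simp add: s_def)
    ultimately have "f q = f p"
      using LIMSEQ_unique by blast
    then show ?thesis
      using q q_ball in_ball dist_q by (auto simp: s_def)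
  qed
  then show thesis
    using that[OF B] by blast
qed

section \<open>The asymptotic rate\<close>

text \<open>Here \<open>p\<close> is the limit of the iterates. Linearization errors are small
  relative to \<open>norm (\<theta> k - p)\<close>; assumption \<open>C\<close> makes them small
  relative to the gradient, so they raise the contraction factor by at most
  \<open>e\<close>.\<close>

lemma gradient_descent_gradients_contract:
  fixes f :: "'a::euclidean_space \<Rightarrow> real"
  assumes f: "\<And>x. x \<in> U \<Longrightarrow> GDERIV f x :> grad f x" and U: "open U" "p \<in> U"
    and H: "(grad f has_derivative H) (at p)"
    and \<mu>: "0 < \<mu>" "\<mu> \<le> L" and "0 < \<gamma>"
    and min: "\<And>x. x \<in> U \<Longrightarrow> f p \<le> f x"
    and PL: "\<And>x. x \<in> U \<Longrightarrow> 2 * \<mu> * (f x - f p) \<le> (norm (grad f x))\<^sup>2"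
    and Lip: "\<And>x y. x \<in> U \<Longrightarrow> y \<in> U \<Longrightarrow> norm (grad f x - grad f y) \<le> L * norm (x - y)"
    and gd: "gradient_descent f \<gamma> \<theta>" and lim: "\<theta> \<longlonglongrightarrow> p"
    and C: "\<forall>\<^sub>F k in sequentially. norm (\<theta> k - p) \<le> C * norm (grad f (\<theta> k))"
    and "0 < e"
  shows "\<forall>\<^sub>F k in sequentially. norm (grad f (\<theta> (Suc k)))
      \<le> (max \<bar>1 - \<gamma> * \<mu>\<bar> \<bar>1 - \<gamma> * L\<bar> + e) * norm (grad f (\<theta> k))"
proof -
  let ?\<rho> = "max \<bar>1 - \<gamma> * \<mu>\<bar> \<bar>1 - \<gamma> * L\<bar>"
  interpret H: bounded_linear H
    using H by (rule has_derivative_bounded_linear)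
  note hessian = hessian_at_minimum_of_PL_function[OF f U H \<mu>(1) min PL Lip]
  have contr: "norm (H x - \<gamma> *\<^sub>R H (H x)) \<le> ?\<rho> * norm (H x)" for x
    using symmetric_contraction_on_range[OF H.linear_axioms second_derivative_symmetric[OF f U H]
        hessian \<mu>(1) \<open>0 < \<gamma>\<close>] .
  have g0: "grad f p = 0"
    using grad_zero_at_local_minimum[OF f U] U min by blast
  have Suc: "\<theta> (Suc k) = \<theta> k - \<gamma> *\<^sub>R grad f (\<theta> k)" for k
    using gd by (simp add: gradient_descent_def)
  \<comment> \<open>Bounds the total coefficient of \<open>\<delta> * norm g\<close> in the final
    estimate, so that \<open>\<delta> = e / D\<close> gives the error
    \<open>e * norm g\<close>.\<close>
  define D where "D = (1 + ?\<rho> + \<gamma> * L) * \<bar>C\<bar> + \<gamma> + 1"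
  have D: "0 < D"
    using \<mu> \<open>0 < \<gamma>\<close> unfolding D_def by (intro add_nonneg_pos add_nonneg_nonneg mult_nonneg_nonneg) auto
  define \<delta> where "\<delta> = e / D"
  have \<delta>: "0 < \<delta>" using D \<open>0 < e\<close> by (simp add: \<delta>_def)
  obtain d where d: "0 < d"
    "\<And>y. norm (y - p) < d \<Longrightarrow> norm (grad f y - grad f p - H (y - p)) \<le> \<delta> * norm (y - p)"
    using H \<delta> unfolding has_derivative_at_alt by blast
  have ev: "\<forall>\<^sub>F k in sequentially. norm (\<theta> k - p) < d"
    using tendstoD[OF lim d(1)] by (simp add: dist_norm)
  then have "\<forall>\<^sub>F k in sequentially. norm (\<theta> (Suc k) - p) < d"
    by (subst eventually_sequentially_Suc)
  with ev C show ?thesis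
  proof eventually_elim
    case (elim k)
    define u g g' where "u = \<theta> k - p" and "g = grad f (\<theta> k)" and "g' = grad f (\<theta> (Suc k))"
    have u': "\<theta> (Suc k) - p = u - \<gamma> *\<^sub>R g"
      by (simp add: Suc u_def g_def)
    have 1: "norm (g - H u) \<le> \<delta> * norm u"
      using d(2)[OF elim(1)] by (simp add: u_def g_def g0)
    have 2: "norm (g' - H (u - \<gamma> *\<^sub>R g)) \<le> \<delta> * norm (u - \<gamma> *\<^sub>R g)"
      using d(2)[OF elim(3)] by (simp add: u' g'_def g0)
    have "norm (u - \<gamma> *\<^sub>R g) \<le> norm u + \<gamma> * norm g"
      using norm_triangle_ineq4[of u "\<gamma> *\<^sub>R g"] \<open>0 < \<gamma>\<close> by simp
    then have 3: "norm (g' - H (u - \<gamma> *\<^sub>R g)) \<le> \<delta> * (norm u + \<gamma> * norm g)"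
      using 2 \<delta> by (meson order_trans mult_left_mono less_imp_le)
    \<comment> \<open>Replacing \<open>g\<close> by \<open>H u\<close> puts the leading part in the
      range of \<open>H\<close>, where the contraction bound holds.\<close>
    have eq: "H (u - \<gamma> *\<^sub>R g) = (H u - \<gamma> *\<^sub>R H (H u)) - \<gamma> *\<^sub>R H (g - H u)"
      by (simp add: H.diff H.scale algebra_simps)
    have "norm (H (u - \<gamma> *\<^sub>R g)) \<le> norm (H u - \<gamma> *\<^sub>R H (H u)) + \<gamma> * norm (H (g - H u))"
      unfolding eq using norm_triangle_ineq4[of "H u - \<gamma> *\<^sub>R H (H u)" "\<gamma> *\<^sub>R H (g - H u)"] \<open>0 < \<gamma>\<close>
      by simp
    also have "\<dots> \<le> ?\<rho> * norm (H u) + \<gamma> * (L * (\<delta> * norm u))"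
    proof -
      have "norm (H (g - H u)) \<le> L * (\<delta> * norm u)"
        using hessian(3)[of "g - H u"] mult_left_mono[OF 1, of L] \<mu> by linarith
      then show ?thesis
        using contr[of u] mult_left_mono[of _ _ \<gamma>] \<open>0 < \<gamma>\<close> by (intro add_mono) auto
    qed
    also have "\<dots> \<le> ?\<rho> * (norm g + \<delta> * norm u) + \<gamma> * (L * (\<delta> * norm u))"
      using 1 norm_triangle_sub[of "H u" g]
      by (intro add_right_mono mult_left_mono) (auto simp: norm_minus_commute)
    finally have "norm g' \<le> ?\<rho> * (norm g + \<delta> * norm u) + \<gamma> * (L * (\<delta> * norm u))
        + \<delta> * (norm u + \<gamma> * norm g)"
      using 3 norm_triangle_sub[of g' "H (u - \<gamma> *\<^sub>R g)"] by linarith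
    also have "\<dots> = ?\<rho> * norm g + \<delta> * ((1 + ?\<rho> + \<gamma> * L) * norm u + \<gamma> * norm g)"
      by (simp add: algebra_simps)
    also have "\<dots> \<le> ?\<rho> * norm g + \<delta> * ((1 + ?\<rho> + \<gamma> * L) * (\<bar>C\<bar> * norm g) + \<gamma> * norm g)"
    proof -
      have "norm u \<le> \<bar>C\<bar> * norm g"
        using elim(2) mult_right_mono[OF abs_ge_self[of C], of "norm g"]
        by (simp add: u_def g_def)
      then show ?thesis
        using \<delta> \<mu> \<open>0 < \<gamma>\<close> by (intro add_mono mult_left_mono) auto
    qed
    also have "\<dots> \<le> ?\<rho> * norm g + \<delta> * (D * norm g)"
      using \<delta> by (intro add_left_mono mult_left_mono) (auto simp: D_def algebra_simps)
    also have "\<dots> = (?\<rho> + e) * norm g"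
      using D by (simp add: \<delta>_def algebra_simps)
    finally show ?case
      by (simp add: g_def g'_def)
  qed
qed

text \<open>The ratio test with \<open>s / r < 1\<close> makes \<open>a k / r ^ k\<close> summable,
  hence null. The weight is \<open>1 / (r ^ k)\<^sup>2\<close>, so the weighted \<open>b k\<close>
  is squeezed by a multiple of the square of this sequence.\<close>

lemma weighted_tendsto_zero_of_contraction:
  fixes a b :: "nat \<Rightarrow> real"
  assumes a: "\<forall>\<^sub>F k in sequentially. a (Suc k) \<le> s * a k" "\<And>k. 0 \<le> a k"
    and b: "\<forall>\<^sub>F k in sequentially. 0 \<le> b k \<and> b k \<le> C * (a k)\<^sup>2"
    and s: "0 \<le> s" "s < r"
  shows "(\<lambda>k. r powi (- 2 * int k) * b k) \<longlonglongrightarrow> 0"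
proof -
  have r: "0 < r" using s by simp
  obtain N where N: "\<And>k. k \<ge> N \<Longrightarrow> a (Suc k) \<le> s * a k"
    using a(1) unfolding eventually_sequentially by blast
  have "summable (\<lambda>k. a k / r ^ k)"
  proof (rule summable_ratio_test)
    show "s / r < 1" using s by simp
    show "norm (a (Suc k) / r ^ Suc k) \<le> s / r * norm (a k / r ^ k)" if "N \<le> k" for k
      using N[OF that] a(2) r by (simp add: field_simps)
  qed
  then have upper_lim: "(\<lambda>k. C * (a k / r ^ k)\<^sup>2) \<longlonglongrightarrow> C * 0\<^sup>2"
    by (intro tendsto_intros summable_LIMSEQ_zero)
  have weight: "r powi (- 2 * int k) = 1 / (r ^ k)\<^sup>2" for k
    by (simp add: power_int_minus power_int_def nat_mult_distrib power_mult[symmetric]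
        mult.commute field_simps)
  have nonneg: "\<forall>\<^sub>F k in sequentially. 0 \<le> r powi (- 2 * int k) * b k"
    using b by eventually_elim (subst weight, simp)
  have upper: "\<forall>\<^sub>F k in sequentially. r powi (- 2 * int k) * b k \<le> C * (a k / r ^ k)\<^sup>2"
    using b by eventually_elim (subst weight, use r in \<open>simp add: power_divide divide_right_mono\<close>)
  have "C * 0\<^sup>2 = 0" by simp
  then show ?thesis
    using tendsto_sandwich[OF nonneg upper tendsto_const] upper_lim by metis
qed

section \<open>Choice of the neighborhood and transfer of the rate to the limit point\<close>

theorem corollary1p4:
  fixes f :: "real ^ 'd \<Rightarrow> real"
    and \<mu> L \<gamma> :: real
    and \<theta>star :: "real ^ 'd"
  assumes "0 < \<mu>" and "\<mu> \<le> L"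
    and "C1_on f UNIV"
    and "0 < \<gamma>" and "\<gamma> < 2 / L"
    and "regular_point \<mu> L f \<theta>star"
  shows "\<exists>V. open V \<and> \<theta>star \<in> V \<and>
    (\<forall>\<theta> :: nat \<Rightarrow> real ^ 'd. gradient_descent f \<gamma> \<theta> \<longrightarrow> (\<exists>N. \<theta> N \<in> V) \<longrightarrow>
      (\<exists>\<theta>inf. \<theta> \<longlonglongrightarrow> \<theta>inf \<and> local_minimum f \<theta>inf \<and> f \<theta>inf = f \<theta>star \<and>
        (\<forall>\<epsilon>>0.
          limsup (\<lambda>k. ereal ((max \<bar>1 - \<gamma> * \<mu>\<bar> \<bar>1 - \<gamma> * L\<bar> + \<epsilon>) powi (- 2 * int k)
            * (norm (\<theta> k - \<theta>inf))\<^sup>2)) = 0 \<and>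
          limsup (\<lambda>k. ereal ((max \<bar>1 - \<gamma> * \<mu>\<bar> \<bar>1 - \<gamma> * L\<bar> + \<epsilon>) powi (- 2 * int k)
            * (f (\<theta> k) - f \<theta>inf))) = 0)))"
proof -
  let ?\<rho> = "max \<bar>1 - \<gamma> * \<mu>\<bar> \<bar>1 - \<gamma> * L\<bar>"
  obtain U where U: "open U" "\<theta>star \<in> U" "C2_on f U" "\<And>x. x \<in> U \<Longrightarrow> f \<theta>star \<le> f x"
    "\<And>x. x \<in> U \<Longrightarrow> 2 * \<mu> * (f x - f \<theta>star) \<le> (norm (grad f x))\<^sup>2"
    "\<And>x y. x \<in> U \<Longrightarrow> y \<in> U \<Longrightarrow> norm (grad f x - grad f y) \<le> L * norm (x - y)"
    using assms(6) unfolding regular_point_def by auto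
  obtain R where R: "0 < R" "ball \<theta>star R \<subseteq> U"
    using U(1,2) open_contains_ball by blast
  define r where "r = R / 3"
  have r: "0 < r" "ball \<theta>star (3 * r) \<subseteq> U"
    using R by (auto simp: r_def)
  have "ball \<theta>star r \<subseteq> ball \<theta>star (3 * r)"
    using r(1) by (intro subset_ball) simp
  then have near: "\<And>x. x \<in> ball \<theta>star r \<Longrightarrow> x \<in> U"
    using r(2) by blast
  have f: "GDERIV f x :> grad f x" for x
    using assms(3) GDERIV_grad unfolding C1_on_def by blast
  then have cont: "continuous_on UNIV f"
    unfolding gderiv_def
    by (meson continuous_at_imp_continuous_on has_derivative_continuous)
  obtain B where B: "0 < B" and conv:
    "\<And>\<theta>. gradient_descent f \<gamma> \<theta> \<Longrightarrow> \<theta> 0 \<in> ball \<theta>star r \<Longrightarrow>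
      norm (\<theta> 0 - \<theta>star) + B * sqrt (f (\<theta> 0) - f \<theta>star) < r \<Longrightarrow>
      \<exists>q \<in> ball \<theta>star r. \<theta> \<longlonglongrightarrow> q \<and> f q = f \<theta>star \<and>
        (\<forall>k. \<theta> k \<in> ball \<theta>star r \<and> norm (\<theta> k - q) \<le> B * sqrt (f (\<theta> k) - f \<theta>star))"
    using gradient_descent_PL_converges[of \<mu> L \<gamma> \<theta>star r f, OF assms(1,2,4,5) f
        U(4)[OF subsetD[OF r(2)]] U(5)[OF subsetD[OF r(2)]]
        U(6)[OF subsetD[OF r(2)] subsetD[OF r(2)]]]
    by blast
  \<comment> \<open>Exactly the start condition of \<open>conv\<close>; it is open because
    \<open>f\<close> is continuous, and it contains \<open>\<theta>star\<close> because the gap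
    vanishes there.\<close>
  define V where "V = ball \<theta>star r \<inter> {x. norm (x - \<theta>star) + B * sqrt (f x - f \<theta>star) < r}"
  have "open V"
    unfolding V_def by (intro open_Int open_ball open_Collect_less continuous_intros cont)
  moreover have "\<theta>star \<in> V"
    using r by (simp add: V_def)
  moreover have "\<exists>q. \<theta> \<longlonglongrightarrow> q \<and> local_minimum f q \<and> f q = f \<theta>star \<and>
        (\<forall>\<epsilon>>0.
          limsup (\<lambda>k. ereal ((?\<rho> + \<epsilon>) powi (- 2 * int k) * (norm (\<theta> k - q))\<^sup>2)) = 0 \<and>
          limsup (\<lambda>k. ereal ((?\<rho> + \<epsilon>) powi (- 2 * int k) * (f (\<theta> k) - f q))) = 0)"
    if gd: "gradient_descent f \<gamma> \<theta>" and N: "\<theta> N \<in> V" for \<theta> N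
  proof -
    \<comment> \<open>The scheme is autonomous, so entering \<open>V\<close> at index
      \<open>N\<close> amounts to starting there.\<close>
    have "gradient_descent f \<gamma> (\<lambda>k. \<theta> (k + N))"
      using gd by (simp add: gradient_descent_def)
    from conv[OF this] N obtain q where q: "q \<in> ball \<theta>star r" "(\<lambda>k. \<theta> (k + N)) \<longlonglongrightarrow> q"
      "f q = f \<theta>star" and
      \<theta>: "\<And>k. \<theta> (k + N) \<in> ball \<theta>star r"
        "\<And>k. norm (\<theta> (k + N) - q) \<le> B * sqrt (f (\<theta> (k + N)) - f \<theta>star)"
      by (auto simp: V_def)
    have lim: "\<theta> \<longlonglongrightarrow> q"
      using q(2) by (rule LIMSEQ_offset)
    have qU: "q \<in> U" using near q by blast
    have "local_minimum f q"
      unfolding local_minimum_def q(3) using U(1,4) qU by blast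
    have gap: "0 \<le> f (\<theta> k) - f q" "f (\<theta> k) - f q \<le> 1 / (2 * \<mu>) * (norm (grad f (\<theta> k)))\<^sup>2"
      "norm (\<theta> k - q) \<le> B / sqrt (2 * \<mu>) * norm (grad f (\<theta> k))" if "k \<ge> N" for k
    proof -
      have kU: "\<theta> k \<in> U"
        using near \<theta>(1)[of "k - N"] that by simp
      show "0 \<le> f (\<theta> k) - f q"
        using U(4)[OF kU] q by simp
      show *: "f (\<theta> k) - f q \<le> 1 / (2 * \<mu>) * (norm (grad f (\<theta> k)))\<^sup>2"
        using U(5)[OF kU] q assms(1) by (simp add: field_simps)
      have "sqrt (f (\<theta> k) - f q) \<le> norm (grad f (\<theta> k)) / sqrt (2 * \<mu>)"
        using real_sqrt_le_mono[OF *] by (simp add: real_sqrt_divide real_sqrt_mult)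
      then have "B * sqrt (f (\<theta> k) - f q) \<le> B * (norm (grad f (\<theta> k)) / sqrt (2 * \<mu>))"
        using B by (intro mult_left_mono) auto
      then show "norm (\<theta> k - q) \<le> B / sqrt (2 * \<mu>) * norm (grad f (\<theta> k))"
        using \<theta>(2)[of "k - N"] that q by simp
    qed
    \<comment> \<open>The linearization is taken at the limit \<open>q\<close>, which may differ
      from \<open>\<theta>star\<close>. Since \<open>q\<close> lies in \<open>U\<close> and has the
      same value, the regularity inequalities on \<open>U\<close> hold relative to \<open>q\<close>
      too.\<close>
    obtain H where H: "(grad f has_derivative H) (at q)"
      using C2_on_grad_differentiable U(1,3) qU by blast
    have "limsup (\<lambda>k. ereal ((?\<rho> + \<epsilon>) powi (- 2 * int k) * (norm (\<theta> k - q))\<^sup>2)) = 0 \<and>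
        limsup (\<lambda>k. ereal ((?\<rho> + \<epsilon>) powi (- 2 * int k) * (f (\<theta> k) - f q))) = 0" if "0 < \<epsilon>" for \<epsilon>
    proof -
      \<comment> \<open>Only half of \<open>\<epsilon>\<close> is spent here: the contraction factor
        must stay strictly below the base \<open>?\<rho> + \<epsilon>\<close> of the weight.\<close>
      have contract: "\<forall>\<^sub>F k in sequentially.
          norm (grad f (\<theta> (Suc k))) \<le> (?\<rho> + \<epsilon> / 2) * norm (grad f (\<theta> k))"
      proof (rule gradient_descent_gradients_contract[OF f U(1) qU H assms(1,2,4) _ _ U(6) gd lim])
        show "\<forall>\<^sub>F k in sequentially. norm (\<theta> k - q) \<le> B / sqrt (2 * \<mu>) * norm (grad f (\<theta> k))"
          using gap(3) by (auto simp: eventually_sequentially)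
      qed (use U q \<open>0 < \<epsilon>\<close> in auto)
      have "\<forall>\<^sub>F k in sequentially. 0 \<le> (norm (\<theta> k - q))\<^sup>2 \<and>
          (norm (\<theta> k - q))\<^sup>2 \<le> (B / sqrt (2 * \<mu>))\<^sup>2 * (norm (grad f (\<theta> k)))\<^sup>2"
        unfolding eventually_sequentially power_mult_distrib[symmetric]
        using gap(3) by (auto intro!: power_mono exI[of _ N])
      from weighted_tendsto_zero_of_contraction[OF contract norm_ge_zero this]
      have 1: "(\<lambda>k. (?\<rho> + \<epsilon>) powi (- 2 * int k) * (norm (\<theta> k - q))\<^sup>2) \<longlonglongrightarrow> 0"
        using \<open>0 < \<epsilon>\<close> by simp
      have "\<forall>\<^sub>F k in sequentially. 0 \<le> f (\<theta> k) - f q \<and>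
          f (\<theta> k) - f q \<le> 1 / (2 * \<mu>) * (norm (grad f (\<theta> k)))\<^sup>2"
        unfolding eventually_sequentially using gap(1,2) by blast
      from weighted_tendsto_zero_of_contraction[OF contract norm_ge_zero this]
      have 2: "(\<lambda>k. (?\<rho> + \<epsilon>) powi (- 2 * int k) * (f (\<theta> k) - f q)) \<longlonglongrightarrow> 0"
        using \<open>0 < \<epsilon>\<close> by simp
      show ?thesis
        using 1 2 by (auto intro!: lim_imp_Limsup simp: zero_ereal_def)
    qed
    then show ?thesis
      using lim \<open>local_minimum f q\<close> q(3) by blast
  qed
  ultimately show ?thesis by blast
qed

end
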